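(* Let $n,s_1,s_2,r$ be non-negative integers such that $0\le s_1<s_2\le n-1$. Let $A$ and $B$ be two square complex matrices of order $r$ such that $AB=BA$. If $P_n^{s_1}\otimes A+P_n^{s_2}\otimes B$ and $A^{\,n\backslash(s_2-s_1)}-(-B)^{\,n\backslash(s_2-s_1)}$ are non-singular, then $$\left(P_n^{s_1}\otimes A+P_n^{s_2}\otimes B\right)^{-1}=\sum_{i=0}^{n-1}P_n^{i}\otimes\Omega_{n,s_2-s_1}(i+s_1).$$
   Context: Matrix indices run over $[n]:=\{0,1,\dots,n-1\}$. $P_n$ is the $n\times n$ permutation matrix with $(P_n)_{i,j}=1$ if $j\equiv i+1\pmod n$ and $0$ otherwise; $P_n^0=I_n$. $\otimes$ is the Kronecker product. $(n,s)$ denotes the greatest common divisor and $n\backslash s:=n/(n,s)$. For integers $0<s<n$ and $i\in[n]$, there are unique $h\in[(n,s)]$ and $t\in[n\backslash s]$ with $i\equiv ts+h\pmod n$; put $\operatorname{cycle}_{n,s}(i):=h$ and $\operatorname{pos}_{n,s}(i):=t$. For an arbitrary integer argument, these functions are evaluated at its residue modulo $n$ in $[n]$. With $\delta$ the Kronecker delta, and whenever $A^{n\backslash s}-(-B)^{n\backslash s}$ is invertible, $$\Omega_{n,s}(i):=(-1)^{\operatorname{pos}_{n,s}(i)}\,\delta_{0,\operatorname{cycle}_{n,s}(i)}\,B^{\operatorname{pos}_{n,s}(i)}\,A^{(n\backslash s)-1-\operatorname{pos}_{n,s}(i)}\left[A^{n\backslash s}-(-B)^{n\backslash s}\right]^{-1},$$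 with the convention that a zeroth power of an $r\times r$ matrix is $I_r$. *)

theory Defs
  imports
    "Jordan_Normal_Form.Gauss_Jordan_Elimination"
    "HOL-Number_Theory.Cong"
begin

text \<open>
  Matrices are those of \<open>Jordan_Normal_Form.Matrix\<close>: the dimensions are natural numbers carried by
  the matrix, indices start at 0, and \<open>A ^\<^sub>m 0\<close> is the identity matrix (also for singular \<open>A\<close>).
\<close>

definition perm_P :: "nat \<Rightarrow> complex mat" where
  "perm_P n = mat n n (\<lambda>(i, j). if [j = i + 1] (mod n) then 1 else 0)"

text \<open>Block convention: the block of \<open>A \<otimes>\<^sub>k B\<close> at block position \<open>(i, j)\<close> is \<open>A $$ (i, j) \<cdot>\<^sub>m B\<close>.\<close>

definition kronecker_mat :: "complex mat \<Rightarrow> complex mat \<Rightarrow> complex mat" (infixl \<open>\<otimes>\<^sub>k\<close> 70) where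
  "A \<otimes>\<^sub>k B = mat (dim_row A * dim_row B) (dim_col A * dim_col B)
     (\<lambda>(i, j). A $$ (i div dim_row B, j div dim_col B) * B $$ (i mod dim_row B, j mod dim_col B))"

definition quot_gcd :: "nat \<Rightarrow> nat \<Rightarrow> nat" where
  "quot_gcd n s = n div gcd n s"

text \<open>
  The pair \<open>(cycle i, pos i)\<close>. As the defining condition is a congruence modulo \<open>n\<close>, it depends on the
  integer \<open>i\<close> only through its residue. The lemma below shows that for \<open>0 < s < n\<close> the definite
  description is proper.
\<close>

definition cycle_pos :: "nat \<Rightarrow> nat \<Rightarrow> int \<Rightarrow> nat \<times> nat" where
  "cycle_pos n s i = (THE (h, t). h < gcd n s \<and> t < quot_gcd n s \<and>
     [i = int t * int s + int h] (mod int n))"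

definition cycle :: "nat \<Rightarrow> nat \<Rightarrow> int \<Rightarrow> nat" where
  "cycle n s i = fst (cycle_pos n s i)"

definition pos :: "nat \<Rightarrow> nat \<Rightarrow> int \<Rightarrow> nat" where
  "pos n s i = snd (cycle_pos n s i)"

lemma cycle_pos_ex1:
  fixes n s :: nat and i :: int
  assumes "0 < s" "s < n"
  shows "\<exists>!(h, t). h < gcd n s \<and> t < quot_gcd n s \<and> [i = int t * int s + int h] (mod int n)"
proof -
  define g where "g = int (gcd n s)"
  define m where "m = int (quot_gcd n s)"
  define s' where "s' = int s div g"
  have g0: "g > 0" using assms by (simp add: g_def)
  have nm: "int n = m * g"
    unfolding m_def g_def quot_gcd_def
    by (metis dvd_div_mult_self gcd_dvd1 of_nat_mult)
  have ss: "int s = s' * g" unfolding s'_def g_def by simp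
  have m0: "m > 0" using nm g0 assms by (metis of_nat_0_less_iff zero_less_mult_pos2 less_trans)
  have cop: "coprime s' m"
    using assms unfolding s'_def m_def g_def quot_gcd_def
    by (metis coprime_commute coprime_int_iff div_gcd_coprime gr_implies_not0 of_nat_div)
  define h where "h = i mod g"
  define q where "q = i div g"
  have ih: "i = q * g + h" by (simp add: h_def q_def)
  obtain x where x: "[s' * x = 1] (mod m)"
    using cop cong_solve_coprime_int by blast
  define t where "t = (x * q) mod m"
  have "[t * s' = (s' * x) * q] (mod m)"
    unfolding t_def by (metis cong_def mod_mult_left_eq mult.commute mult.left_commute)
  also have "[(s' * x) * q = 1 * q] (mod m)" using x by (rule cong_scalar_right)
  finally have "[q = t * s'] (mod m)" by (simp add: cong_sym)
  then have "m dvd q - t * s'" by (simp add: cong_iff_dvd_diff)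
  then have "m * g dvd (q - t * s') * g" by simp
  moreover have "(q - t * s') * g = i - (t * int s + h)"
    unfolding ih ss by (simp add: algebra_simps)
  ultimately have ex: "[i = t * int s + h] (mod int n)"
    by (simp add: cong_iff_dvd_diff nm)
  have hb: "0 \<le> h" "h < g" and tb: "0 \<le> t" "t < m"
    using g0 m0 by (simp_all add: h_def t_def)
  show ?thesis
  proof (rule ex1I[of _ "(nat h, nat t)"])
    show "case (nat h, nat t) of (h, t) \<Rightarrow>
        h < gcd n s \<and> t < quot_gcd n s \<and> [i = int t * int s + int h] (mod int n)"
      using ex hb tb by (simp add: g_def m_def nat_less_iff)
  next
    fix p :: "nat \<times> nat"
    assume "case p of (h, t) \<Rightarrow>
        h < gcd n s \<and> t < quot_gcd n s \<and> [i = int t * int s + int h] (mod int n)"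
    then obtain a b where p: "p = (a, b)" and a: "int a < g" and b: "int b < m"
      and c: "[i = int b * int s + int a] (mod int n)"
      by (auto simp: g_def m_def split: prod.splits)
    from c ex have c2: "[int b * int s + int a = t * int s + h] (mod int n)"
      using cong_sym cong_trans by blast
    then have "m * g dvd (int b * int s + int a) - (t * int s + h)"
      by (simp add: cong_iff_dvd_diff nm)
    then obtain k where k: "(int b * int s + int a) - (t * int s + h) = m * g * k" by (auto elim: dvdE)
    then have "int a - h = g * (m * k - int b * s' + t * s')"
      unfolding ss by (simp add: algebra_simps)
    then have "[int a = h] (mod g)" by (simp add: cong_iff_dvd_diff)
    then have ah: "int a = h" using a hb by (simp add: cong_def)
    have "g * ((int b - t) * s') = g * (m * k)"
      using k unfolding ss ah by (simp add: algebra_simps)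
    then have "(int b - t) * s' = m * k" using g0 by simp
    then have "m dvd (int b - t) * s'" by simp
    then have "m dvd int b - t" using cop by (simp add: coprime_commute coprime_dvd_mult_left_iff)
    then have "[int b = t] (mod m)" by (simp add: cong_iff_dvd_diff)
    then have "int b = t" using b tb by (simp add: cong_def)
    with ah p show "p = (nat h, nat t)" by auto
  qed
qed

text \<open>Only meaningful when the bracketed matrix is invertible: \<open>mat_inverse\<close> returns an option, which
  is \<open>None\<close> for singular matrices.\<close>

definition Omega :: "nat \<Rightarrow> nat \<Rightarrow> complex mat \<Rightarrow> complex mat \<Rightarrow> int \<Rightarrow> complex mat" where
  "Omega n s A B i =
     ((- 1) ^ pos n s i * (if cycle n s i = 0 then 1 else 0)) \<cdot>\<^sub>m
       (B ^\<^sub>m pos n s i * A ^\<^sub>m (quot_gcd n s - 1 - pos n s i)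
         * the (mat_inverse (A ^\<^sub>m quot_gcd n s - (- B) ^\<^sub>m quot_gcd n s)))"

end

theory Submission
  imports Defs
begin

text \<open>
  Since \<open>P\<^sub>n\<^sup>n = I\<close>, block circulant matrices \<open>\<Sum>\<^sub>i P\<^sub>n\<^sup>i \<otimes> C(i)\<close> multiply by cyclic convolution of their
  coefficients. So the claimed inverse works as soon as, with \<open>s = s\<^sub>2 - s\<^sub>1\<close>, the coefficient identity
  \<open>A \<Omega>(i) + B \<Omega>(i - s) = \<delta>\<^sub>0\<^sub>i I\<close> holds for \<open>i\<close> modulo \<open>n\<close>. Passing from \<open>i\<close> to \<open>i - s\<close> keeps the
  cycle and lowers the position by one, so on the cycle of \<open>0\<close> the two terms cancel except at
  \<open>i = 0\<close>, where the position wraps around and the bracket \<open>A\<^sup>m - (-B)\<^sup>m\<close> appears.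
\<close>

section \<open>Cyclic shift matrices\<close>

text \<open>This is \<open>P_n^k\<close> for an arbitrary integer \<open>k\<close>. Integer
  exponents let the index \<open>i - s\<close> be formed without truncation and make sums over
  residues modulo \<open>n\<close> easy to reindex.\<close>

definition shift_mat :: "nat \<Rightarrow> int \<Rightarrow> complex mat" where
  "shift_mat n k = mat n n (\<lambda>(i, j). if [int j = int i + k] (mod int n) then 1 else 0)"

lemma shift_mat_carrier [simp]: "shift_mat n k \<in> carrier_mat n n"
  by (simp add: shift_mat_def)

text \<open>Plays the role of \<open>P_n^n = I\<close>: the exponent counts only modulo
  \<open>n\<close>, which later justifies cyclic shifts of the summation index.\<close>

lemma shift_mat_cong: "[k = l] (mod int n) \<Longrightarrow> shift_mat n k = shift_mat n l"
  unfolding shift_mat_def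
  by (rule cong_mat) (auto, (metis cong_add_lcancel cong_sym cong_trans)+)

lemma shift_mat_0: "shift_mat n 0 = 1\<^sub>m n"
  unfolding shift_mat_def
  by (rule eq_matI) (auto simp: cong_int_iff cong_def)

lemma shift_mat_mult: "shift_mat n k * shift_mat n l = shift_mat n (k + l)"
proof (rule eq_matI)
  fix i j
  assume "i < dim_row (shift_mat n (k + l))" "j < dim_col (shift_mat n (k + l))"
  then have ij: "i < n" "j < n" by (auto simp: shift_mat_def)
  \<comment> \<open>Row \<open>i\<close> of the first factor has its single 1 in column
    \<open>m\<close>, so only the term \<open>x = m\<close> survives in the product sum.\<close>
  define m where "m = nat ((int i + k) mod int n)"
  have m: "m < n" "int m = (int i + k) mod int n"
    using ij by (simp_all add: m_def nat_less_iff)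
  have eq: "[int x = int i + k] (mod int n) \<longleftrightarrow> x = m" if "x < n" for x
    using that m by (auto simp: cong_def)
  have "(shift_mat n k * shift_mat n l) $$ (i, j) =
      (\<Sum>x\<in>{0..<n}. (if [int x = int i + k] (mod int n) then 1 else 0)
        * (if [int j = int x + l] (mod int n) then 1 else 0))"
    using ij by (simp add: shift_mat_def scalar_prod_def)
  also have "\<dots> = (\<Sum>x\<in>{0..<n}. if x = m
      then (if [int j = int m + l] (mod int n) then 1 else 0) else 0)"
    by (rule sum.cong) (auto simp: eq)
  also have "\<dots> = (if [int j = int m + l] (mod int n) then 1 else 0)"
    using m by simp
  also have "[int j = int m + l] (mod int n) \<longleftrightarrow> [int j = int i + (k + l)] (mod int n)"
    unfolding m(2) cong_def by (simp add: mod_add_left_eq add.assoc)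
  finally show "(shift_mat n k * shift_mat n l) $$ (i, j) = shift_mat n (k + l) $$ (i, j)"
    using ij by (simp add: shift_mat_def)
qed (simp_all add: shift_mat_def)

lemma perm_P_eq_shift_mat: "perm_P n = shift_mat n 1"
  unfolding perm_P_def shift_mat_def
  by (rule cong_mat) (auto simp flip: cong_int_iff simp: add.commute)

lemma perm_P_pow: "perm_P n ^\<^sub>m k = shift_mat n (int k)"
proof (induction k)
  case 0
  then show ?case by (simp add: shift_mat_0 perm_P_def)
next
  case (Suc k)
  then show ?case
    by (simp add: perm_P_eq_shift_mat shift_mat_mult add.commute)
qed

section \<open>Algebra of the Kronecker product\<close>

lemma kronecker_mat_carrier [simp]:
  "A \<in> carrier_mat a b \<Longrightarrow> B \<in> carrier_mat c d \<Longrightarrow> A \<otimes>\<^sub>k B \<in> carrier_mat (a * c) (b * d)"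
  by (auto simp: kronecker_mat_def)

lemma kronecker_mat_index:
  assumes "A \<in> carrier_mat a b" "B \<in> carrier_mat c d" "i < a * c" "j < b * d"
  shows "(A \<otimes>\<^sub>k B) $$ (i, j) = A $$ (i div c, j div d) * B $$ (i mod c, j mod d)"
  using assms by (auto simp: kronecker_mat_def)

text \<open>The range below \<open>m * n\<close> consists of \<open>m\<close> consecutive blocks of
  length \<open>n\<close>; the quotient names the block and the remainder the place in it. This
  separates the two inner indices of a product of Kronecker products.\<close>

lemma sum_div_mod:
  fixes f :: "nat \<Rightarrow> nat \<Rightarrow> 'a :: comm_monoid_add"
  shows "(\<Sum>k<m * n. f (k div n) (k mod n)) = (\<Sum>i<m. \<Sum>j<n. f i j)"
proof -
  have "(\<Sum>k<m * n. f (k div n) (k mod n))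
      = (\<Sum>i<m. \<Sum>k\<in>{i * n..<i * n + n}. f (k div n) (k mod n))"
    by (simp add: sum.nat_group)
  also have "\<dots> = (\<Sum>i<m. \<Sum>j<n. f i j)"
  proof (rule sum.cong[OF refl])
    fix i
    have "(\<Sum>k\<in>{i * n..<i * n + n}. f (k div n) (k mod n))
        = (\<Sum>j\<in>{0..<n}. f ((j + i * n) div n) ((j + i * n) mod n))"
      using sum.shift_bounds_nat_ivl[of "\<lambda>k. f (k div n) (k mod n)" 0 "i * n" n]
      by (simp add: add.commute)
    also have "\<dots> = (\<Sum>j<n. f i j)"
      by (rule sum.cong) auto
    finally show "(\<Sum>k\<in>{i * n..<i * n + n}. f (k div n) (k mod n)) = (\<Sum>j<n. f i j)" .
  qed
  finally show ?thesis .
qed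

text \<open>The mixed-product rule. Splitting the inner index into quotient and remainder by
  \<open>q\<close> gives a double sum whose summand separates, hence a product of two sums.\<close>

lemma kronecker_mat_mult:
  assumes A: "A \<in> carrier_mat a b" and C: "C \<in> carrier_mat b c"
    and B: "B \<in> carrier_mat p q" and D: "D \<in> carrier_mat q t"
  shows "(A \<otimes>\<^sub>k B) * (C \<otimes>\<^sub>k D) = (A * C) \<otimes>\<^sub>k (B * D)"
proof (rule eq_matI)
  note AC = mult_carrier_mat[OF A C] and BD = mult_carrier_mat[OF B D]
  note AB = kronecker_mat_carrier[OF A B] and CD = kronecker_mat_carrier[OF C D]
  note K = kronecker_mat_carrier[OF AC BD]
  fix i j
  assume "i < dim_row ((A * C) \<otimes>\<^sub>k (B * D))" "j < dim_col ((A * C) \<otimes>\<^sub>k (B * D))"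
  then have ij: "i < a * p" "j < c * t" using K by auto
  \<comment> \<open>Dimensions may be zero, but \<open>i < a * p\<close> already forces
    \<open>p > 0\<close>, so the remainders are in range; likewise for \<open>t\<close>.\<close>
  have dm: "i div p < a" "j div t < c" "i mod p < p" "j mod t < t"
    using ij by (auto simp: less_mult_imp_div_less intro!: mod_less_divisor gr0I)
  have "((A \<otimes>\<^sub>k B) * (C \<otimes>\<^sub>k D)) $$ (i, j)
      = (\<Sum>k<b * q. (A \<otimes>\<^sub>k B) $$ (i, k) * (C \<otimes>\<^sub>k D) $$ (k, j))"
    using AB CD ij by (simp add: scalar_prod_def atLeast0LessThan)
  also have "\<dots> = (\<Sum>k<b * q. (A $$ (i div p, k div q) * B $$ (i mod p, k mod q))
      * (C $$ (k div q, j div t) * D $$ (k mod q, j mod t)))"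
    using ij by (intro sum.cong) (auto simp: kronecker_mat_index[OF A B] kronecker_mat_index[OF C D])
  also have "\<dots> = (\<Sum>k<b. \<Sum>l<q. (A $$ (i div p, k) * B $$ (i mod p, l))
      * (C $$ (k, j div t) * D $$ (l, j mod t)))"
    by (rule sum_div_mod)
  also have "\<dots> = (\<Sum>k<b. A $$ (i div p, k) * C $$ (k, j div t))
      * (\<Sum>l<q. B $$ (i mod p, l) * D $$ (l, j mod t))"
    unfolding sum_product by (intro sum.cong refl) (simp add: ac_simps)
  also have "\<dots> = (A * C) $$ (i div p, j div t) * (B * D) $$ (i mod p, j mod t)"
    using A B C D dm by (simp add: scalar_prod_def atLeast0LessThan)
  also have "\<dots> = ((A * C) \<otimes>\<^sub>k (B * D)) $$ (i, j)"
    using kronecker_mat_index[OF AC BD ij] by simp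
  finally show "((A \<otimes>\<^sub>k B) * (C \<otimes>\<^sub>k D)) $$ (i, j) = ((A * C) \<otimes>\<^sub>k (B * D)) $$ (i, j)" .
qed (simp_all add: kronecker_mat_def)

lemma kronecker_mat_add_right:
  assumes A: "A \<in> carrier_mat a b" and B: "B \<in> carrier_mat c d" and C: "C \<in> carrier_mat c d"
  shows "A \<otimes>\<^sub>k (B + C) = A \<otimes>\<^sub>k B + A \<otimes>\<^sub>k C"
proof (rule eq_matI)
  note K = kronecker_mat_carrier[OF A B] kronecker_mat_carrier[OF A C]
  fix i j
  assume "i < dim_row (A \<otimes>\<^sub>k B + A \<otimes>\<^sub>k C)" "j < dim_col (A \<otimes>\<^sub>k B + A \<otimes>\<^sub>k C)"
  then have ij: "i < a * c" "j < b * d" using K by auto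
  then have "i mod c < c" "j mod d < d" by (auto intro!: mod_less_divisor gr0I)
  then show "(A \<otimes>\<^sub>k (B + C)) $$ (i, j) = (A \<otimes>\<^sub>k B + A \<otimes>\<^sub>k C) $$ (i, j)"
    using K B C ij
    by (simp add: kronecker_mat_index[OF A B] kronecker_mat_index[OF A C]
        kronecker_mat_index[OF A add_carrier_mat[OF C]] distrib_left)
qed (use A B C in \<open>auto simp: kronecker_mat_def\<close>)

lemma kronecker_mat_zero_right: "A \<in> carrier_mat a b \<Longrightarrow> A \<otimes>\<^sub>k 0\<^sub>m c d = 0\<^sub>m (a * c) (b * d)"
  by (rule eq_matI) (auto simp: kronecker_mat_def intro!: index_zero_mat mod_less_divisor gr0I)

lemma kronecker_mat_one: "1\<^sub>m a \<otimes>\<^sub>k 1\<^sub>m b = 1\<^sub>m (a * b)"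
proof (rule eq_matI)
  fix i j
  assume "i < dim_row (1\<^sub>m (a * b) :: complex mat)" "j < dim_col (1\<^sub>m (a * b) :: complex mat)"
  then have ij: "i < a * b" "j < a * b" by auto
  then have "i mod b < b" "j mod b < b" by (auto intro!: mod_less_divisor gr0I)
  moreover have "i = j \<longleftrightarrow> i div b = j div b \<and> i mod b = j mod b"
    by (metis div_mult_mod_eq)
  ultimately show "(1\<^sub>m a \<otimes>\<^sub>k 1\<^sub>m b) $$ (i, j) = 1\<^sub>m (a * b) $$ (i, j)"
    using ij by (simp add: kronecker_mat_index[of _ a a _ b b] less_mult_imp_div_less)
qed (simp_all add: kronecker_mat_def)

section \<open>Sums over a full period\<close>

text \<open>The map sending \<open>i\<close> to the residue of \<open>i + k\<close> permutes
  \<open>{..<n}\<close>, and periodicity makes \<open>F\<close> blind to the reduction. The setting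
  is an abstract monoid because matrix sums are taken with \<open>finsum\<close>, relative to a
  carrier of fixed dimension.\<close>

lemma (in abelian_monoid) finsum_periodic_shift:
  fixes F :: "int \<Rightarrow> 'a"
  assumes F: "\<And>i. F i \<in> carrier G"
    and per: "\<And>i j. [i = j] (mod int n) \<Longrightarrow> F i = F j"
  shows "(\<Oplus>i\<in>{..<n}. F (int i + k)) = (\<Oplus>i\<in>{..<n}. F (int i))"
proof (cases "n = 0")
  case False
  define h where "h i = nat ((int i + k) mod int n)" for i
  have h: "int (h i) = (int i + k) mod int n" for i using False by (simp add: h_def)
  have inj: "inj_on h {..<n}"
  proof (rule inj_onI)
    fix x y assume xy: "x \<in> {..<n}" "y \<in> {..<n}" "h x = h y"
    then have "[int x + k = int y + k] (mod int n)" by (metis h cong_def)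
    then have "[int x = int y] (mod int n)" by (simp add: cong_add_rcancel)
    with xy show "x = y" by (simp add: cong_def)
  qed
  have "h ` {..<n} \<subseteq> {..<n}"
    using False by (auto simp: h_def nat_less_iff)
  \<comment> \<open>An injective self-map of a finite set is onto.\<close>
  then have img: "h ` {..<n} = {..<n}"
    using inj by (simp add: endo_inj_surj)
  have "(\<Oplus>i\<in>{..<n}. F (int i)) = (\<Oplus>i\<in>h ` {..<n}. F (int i))" by (simp add: img)
  also have "\<dots> = (\<Oplus>i\<in>{..<n}. F (int (h i)))"
    by (rule finsum_reindex) (auto simp: F inj)
  also have "\<dots> = (\<Oplus>i\<in>{..<n}. F (int i + k))"
    by (rule finsum_cong') (auto simp: F h cong_def intro!: per)
  finally show ?thesis by simp
qed simp

section \<open>Inverses and powers of matrices\<close>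

text \<open>Connects the predicate \<open>invertible_mat\<close> with the option-valued
  \<open>mat_inverse\<close>, through the units of the matrix ring.\<close>

lemma invertible_mat_inverse:
  fixes M :: "'a :: field mat"
  assumes M: "M \<in> carrier_mat n n" and inv: "invertible_mat M"
  obtains D where "mat_inverse M = Some D" "M * D = 1\<^sub>m n" "D * M = 1\<^sub>m n" "D \<in> carrier_mat n n"
proof -
  from inv obtain C where C: "M * C = 1\<^sub>m (dim_row M)" "C * M = 1\<^sub>m (dim_row C)"
    unfolding invertible_mat_def inverts_mat_def by auto
  \<comment> \<open>The two-sided inverse \<open>C\<close> comes without dimensions; comparing
    column counts in the two identities shows that it is \<open>n\<close> by
    \<open>n\<close>.\<close>
  have "dim_col C = n" using arg_cong[OF C(1), of dim_col] M by simp
  moreover have "dim_row C = n" using arg_cong[OF C(2), of dim_col] M by simp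
  ultimately have "M \<in> Units (ring_mat TYPE('a) n ())"
    using M C by (auto simp: Units_def ring_mat_def intro!: bexI[of _ C])
  then have "mat_inverse M \<noteq> None" using mat_inverse(1)[OF M, where b = "()"] by blast
  then obtain D where "mat_inverse M = Some D" by blast
  with mat_inverse(2)[OF M] that show thesis by blast
qed

text \<open>Once a two-sided inverse \<open>D\<close> exists, any right inverse equals it, by
  \<open>D = D (M N) = (D M) N = N\<close>. Hence computing one product is enough to identify the
  inverse.\<close>

lemma mat_inverse_eqI:
  fixes M :: "'a :: field mat"
  assumes M: "M \<in> carrier_mat n n" and inv: "invertible_mat M"
    and N: "N \<in> carrier_mat n n" "M * N = 1\<^sub>m n"
  shows "mat_inverse M = Some N"
proof -
  obtain D where D: "mat_inverse M = Some D" "D * M = 1\<^sub>m n" "D \<in> carrier_mat n n"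
    using invertible_mat_inverse[OF M inv] .
  have "D = D * (M * N)" using D N by simp
  also have "\<dots> = (D * M) * N" by (rule assoc_mult_mat[OF D(3) M N(1), symmetric])
  also have "\<dots> = N" using D(2) N(1) by simp
  finally show ?thesis using D(1) by simp
qed

lemma pow_mat_commute:
  assumes "A \<in> carrier_mat r r" "B \<in> carrier_mat r r" "A * B = B * A"
  shows "A * B ^\<^sub>m t = B ^\<^sub>m t * A"
proof (induction t)
  case (Suc t)
  have "A * (B ^\<^sub>m t * B) = (A * B ^\<^sub>m t) * B"
    using assms by (simp add: assoc_mult_mat[of _ r r _ r _ r])
  also have "\<dots> = B ^\<^sub>m t * (A * B)"
    using assms Suc by (simp add: assoc_mult_mat[of _ r r _ r _ r])
  also have "\<dots> = (B ^\<^sub>m t * B) * A"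
    using assms by (simp add: assoc_mult_mat[of _ r r _ r _ r])
  finally show ?case by simp
qed (use assms in simp)

lemma pow_mat_Suc_left: "A \<in> carrier_mat r r \<Longrightarrow> A * A ^\<^sub>m t = A ^\<^sub>m Suc t"
  by (simp add: pow_mat_commute)

lemma pow_mat_uminus:
  fixes B :: "'a :: comm_ring_1 mat"
  assumes B: "B \<in> carrier_mat r r"
  shows "(- B) ^\<^sub>m t = (- 1) ^ t \<cdot>\<^sub>m B ^\<^sub>m t"
proof (induction t)
  case (Suc t)
  have "B ^\<^sub>m t * (- B) = - (B ^\<^sub>m Suc t)"
    using B by (simp add: uminus_mult_right_mat)
  with Suc B show ?case
    by (auto simp: mult_smult_assoc_mat[of _ r r _ r])
qed (use B in auto)

section \<open>Cycle and position modulo \<open>n\<close>\<close>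

lemma cycle_pos_cong: "[i = j] (mod int n) \<Longrightarrow> cycle_pos n s i = cycle_pos n s j"
  unfolding cycle_pos_def
  by (rule arg_cong[where f = The]) (simp add: fun_eq_iff cong_def)

text \<open>Makes \<open>Omega\<close> a function on residues modulo \<open>n\<close>, as the cyclic
  reindexing requires.\<close>

lemma Omega_cong: "[i = j] (mod int n) \<Longrightarrow> Omega n s A B i = Omega n s A B j"
  unfolding Omega_def pos_def cycle_def by (simp add: cycle_pos_cong)

lemma cycle_pos_spec:
  assumes "0 < s" "s < n"
  shows "cycle n s i < gcd n s" "pos n s i < quot_gcd n s"
    "[i = int (pos n s i) * int s + int (cycle n s i)] (mod int n)"
  using theI'[OF cycle_pos_ex1[OF assms, of i]]
  by (auto simp: cycle_def pos_def simp flip: cycle_pos_def split: prod.splits)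

lemma cycle_pos_eqI:
  assumes "0 < s" "s < n" "h < gcd n s" "t < quot_gcd n s"
    and "[i = int t * int s + int h] (mod int n)"
  shows "cycle n s i = h" "pos n s i = t"
proof -
  have "cycle_pos n s i = (h, t)"
    unfolding cycle_pos_def
    by (rule the1_equality[OF cycle_pos_ex1[OF assms(1,2)]]) (use assms in auto)
  then show "cycle n s i = h" "pos n s i = t" by (simp_all add: cycle_def pos_def)
qed

text \<open>With \<open>g = gcd n s\<close>, one has \<open>(n / g) * s = n * (s / g)\<close>. Thus
  \<open>quot_gcd n s\<close> steps of size \<open>s\<close> return to the start, which is why
  positions wrap around.\<close>

lemma dvd_quot_gcd_mult: "n dvd quot_gcd n s * s"
  unfolding quot_gcd_def by (metis div_mult_swap dvd_div_mult dvd_triv_left gcd_dvd1 gcd_dvd2)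

text \<open>Subtracting \<open>s\<close> from \<open>t * s + h\<close> lowers \<open>t\<close> by
  one and keeps \<open>h\<close>. At \<open>t = 0\<close> the coefficient would be
  \<open>-1\<close>, which is replaced by \<open>quot_gcd n s - 1\<close> because
  \<open>quot_gcd n s * s\<close> vanishes modulo \<open>n\<close>. Uniqueness of the representation
  then gives both claims.\<close>

lemma cycle_pos_minus:
  assumes s: "0 < s" "s < n"
  shows "cycle n s (i - int s) = cycle n s i"
    and "pos n s (i - int s) = (if pos n s i = 0 then quot_gcd n s - 1 else pos n s i - 1)"
proof -
  note i = cycle_pos_spec[OF s, of i]
  let ?t = "if pos n s i = 0 then quot_gcd n s - 1 else pos n s i - 1"
  have t: "?t < quot_gcd n s" using i(2) by auto
  have "[int (pos n s i) * int s - int s = int ?t * int s] (mod int n)"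
  proof (cases "pos n s i = 0")
    case True
    have "int n dvd int (quot_gcd n s) * int s"
      using dvd_quot_gcd_mult[of n s] by (metis int_dvd_int_iff of_nat_mult)
    then show ?thesis
      using True i(2) by (simp add: cong_iff_dvd_diff of_nat_diff algebra_simps)
  next
    case False
    then show ?thesis by (simp add: of_nat_diff algebra_simps)
  qed
  then have "[int (pos n s i) * int s - int s + int (cycle n s i)
      = int ?t * int s + int (cycle n s i)] (mod int n)"
    by (simp add: cong_add_rcancel)
  moreover have "[i - int s = int (pos n s i) * int s - int s + int (cycle n s i)] (mod int n)"
    using cong_diff[OF i(3) cong_refl, of "int s"] by (simp add: algebra_simps)
  ultimately have c: "[i - int s = int ?t * int s + int (cycle n s i)] (mod int n)"
    by (rule cong_trans[rotated])
  show "cycle n s (i - int s) = cycle n s i" "pos n s (i - int s) = ?t"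
    using cycle_pos_eqI[OF s i(1) t c] by blast+
qed

section \<open>The coefficient identity for \<open>Omega\<close>\<close>

context
  fixes n s r :: nat and A B :: "complex mat"
  assumes s: "0 < s" "s < n"
    and A: "A \<in> carrier_mat r r" and B: "B \<in> carrier_mat r r" and AB: "A * B = B * A"
    and inv: "invertible_mat (A ^\<^sub>m quot_gcd n s - (- B) ^\<^sub>m quot_gcd n s)"
begin

private abbreviation (input) "m \<equiv> quot_gcd n s"

text \<open>Invertibility of the bracket ensures that \<open>the\<close> is applied to a genuine
  inverse, so that the dimensions are known.\<close>

lemma Omega_carrier: "Omega n s A B i \<in> carrier_mat r r"
proof -
  have M: "A ^\<^sub>m m - (- B) ^\<^sub>m m \<in> carrier_mat r r"
    using B by (intro minus_carrier_mat pow_carrier_mat) simp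
  obtain D where "mat_inverse (A ^\<^sub>m m - (- B) ^\<^sub>m m) = Some D" "D \<in> carrier_mat r r"
    using invertible_mat_inverse[OF M inv] .
  then show ?thesis
    using A B unfolding Omega_def by (auto intro!: smult_carrier_mat mult_carrier_mat[of _ r r])
qed

lemma Omega_recurrence:
  "A * Omega n s A B i + B * Omega n s A B (i - int s) =
    (if [i = 0] (mod int n) then 1\<^sub>m r else 0\<^sub>m r r)"
proof -
  have M: "A ^\<^sub>m m - (- B) ^\<^sub>m m \<in> carrier_mat r r"
    using B by (intro minus_carrier_mat pow_carrier_mat) simp
  obtain D where D: "mat_inverse (A ^\<^sub>m m - (- B) ^\<^sub>m m) = Some D"
      "(A ^\<^sub>m m - (- B) ^\<^sub>m m) * D = 1\<^sub>m r" "D \<in> carrier_mat r r"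
    using invertible_mat_inverse[OF M inv] .
  define h t where "h = cycle n s i" and "t = pos n s i"
  \<comment> \<open>On the cycle of 0, \<open>E k\<close> is the value of \<open>Omega\<close> at
    position \<open>k\<close> without its last factor, the inverse \<open>D\<close>. For
    \<open>Suc k < m\<close> the next two facts give \<open>B * E k = - (A * E (Suc k))\<close>, the
    cancellation behind the identity.\<close>
  define E where "E k = (- 1) ^ k \<cdot>\<^sub>m (B ^\<^sub>m k * A ^\<^sub>m (m - 1 - k))" for k
  have E: "E k \<in> carrier_mat r r" for k
    using A B unfolding E_def by (intro smult_carrier_mat mult_carrier_mat[of _ r r]) simp_all
  \<comment> \<open>The bound \<open>k < m\<close> matters for the truncated subtraction: it yields
    \<open>Suc (m - 1 - k) = m - k\<close>.\<close>
  have AE: "A * E k = (- 1) ^ k \<cdot>\<^sub>m (B ^\<^sub>m k * A ^\<^sub>m (m - k))" if "k < m" for k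
  proof -
    have "A * (B ^\<^sub>m k * A ^\<^sub>m (m - 1 - k)) = (A * B ^\<^sub>m k) * A ^\<^sub>m (m - 1 - k)"
      using A B by (simp add: assoc_mult_mat[of _ r r _ r _ r])
    also have "\<dots> = B ^\<^sub>m k * (A * A ^\<^sub>m (m - 1 - k))"
      using A B by (simp add: pow_mat_commute[OF A B AB] assoc_mult_mat[of _ r r _ r _ r])
    also have "A * A ^\<^sub>m (m - 1 - k) = A ^\<^sub>m (m - k)"
      using pow_mat_Suc_left[OF A, of "m - 1 - k"] that by (simp add: Suc_diff_Suc)
    finally show ?thesis
      using A B mult_smult_distrib[OF A mult_carrier_mat[of "B ^\<^sub>m k" r r "A ^\<^sub>m (m - 1 - k)" r]]
      by (simp add: E_def)
  qed
  have BE: "B * E k = (- 1) ^ k \<cdot>\<^sub>m (B ^\<^sub>m Suc k * A ^\<^sub>m (m - Suc k))" for k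
  proof -
    have "B * (B ^\<^sub>m k * A ^\<^sub>m (m - 1 - k)) = (B * B ^\<^sub>m k) * A ^\<^sub>m (m - 1 - k)"
      using A B by (simp add: assoc_mult_mat[of _ r r _ r _ r])
    then show ?thesis
      using A B mult_smult_distrib[OF B mult_carrier_mat[of "B ^\<^sub>m k" r r "A ^\<^sub>m (m - 1 - k)" r]]
      by (simp add: E_def pow_mat_Suc_left)
  qed
  have Om: "Omega n s A B j = E (pos n s j) * D" if "cycle n s j = 0" for j
    using that A B D
      mult_smult_assoc_mat[OF mult_carrier_mat[of "B ^\<^sub>m pos n s j" r r "A ^\<^sub>m (m - 1 - pos n s j)" r] D(3)]
    by (simp add: Omega_def E_def)
  have Om0: "Omega n s A B j = 0\<^sub>m r r" if "cycle n s j \<noteq> 0" for j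
    using that A B D by (auto simp: Omega_def)
  note cp = cycle_pos_spec[OF s, of i, folded h_def t_def]
  note cm = cycle_pos_minus[OF s, of i, folded h_def t_def]
  have g: "0 < gcd n s" "0 < m" using s cp(2) by auto
  \<comment> \<open>The pair \<open>(0, 0)\<close> represents 0, and representations within the
    bounds are unique.\<close>
  have zero_iff: "[i = 0] (mod int n) \<longleftrightarrow> h = 0 \<and> t = 0"
  proof
    assume "[i = 0] (mod int n)"
    then show "h = 0 \<and> t = 0"
      using cycle_pos_eqI[OF s g] by (simp add: h_def t_def)
  qed (use cp(3) in auto)
  show ?thesis
  proof (cases "h = 0")
    case False
    \<comment> \<open>Both \<open>i\<close> and \<open>i - s\<close> lie on the same cycle, so away
      from the cycle of 0 both terms vanish.\<close>
    then show ?thesis using A B zero_iff cm by (simp add: Om0 flip: h_def)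
  next
    case True
    define u where "u = (if t = 0 then m - 1 else t - 1)"
    have "A * Omega n s A B i + B * Omega n s A B (i - int s) = A * (E t * D) + B * (E u * D)"
      using True cm by (simp add: Om u_def flip: h_def t_def)
    \<comment> \<open>\<open>D\<close> is the rightmost factor of both terms, so it can be pulled
      out and later meets the bracket from the right.\<close>
    also have "\<dots> = (A * E t + B * E u) * D"
      using A B D E by (simp add: assoc_mult_mat[of _ r r _ r _ r] add_mult_distrib_mat[of _ r r _ _ r])
    also have "\<dots> = (if t = 0 then 1\<^sub>m r else 0\<^sub>m r r)"
    proof (cases "t = 0")
      case t0: True
      \<comment> \<open>At the wrap-around \<open>u = m - 1\<close>: the first term is
        \<open>A^m\<close>, the second is \<open>(-1)^(m-1) B^m = -(-B)^m\<close>, and together they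
        form the bracket.\<close>
      have "A * E t + B * E u = A ^\<^sub>m m - (- B) ^\<^sub>m m"
      proof -
        obtain k where k: "m = Suc k" using g by (cases m) auto
        have "A * E 0 = A ^\<^sub>m m" using AE[OF g(2)] A B by (auto intro!: eq_matI)
        moreover have "B * E k = - ((- B) ^\<^sub>m m)"
          using BE[of k] A B unfolding k pow_mat_uminus[OF B] by (auto intro!: eq_matI)
        moreover have "u = k" using t0 k by (simp add: u_def)
        ultimately show ?thesis using A B t0 by (auto intro!: eq_matI)
      qed
      with D t0 show ?thesis by simp
    next
      case False
      then obtain k where k: "t = Suc k" by (cases t) auto
      \<comment> \<open>Here \<open>t = Suc k\<close> and \<open>u = k\<close>: both terms are
        \<open>B^t A^(m-t)\<close> up to sign, with opposite signs.\<close>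
      have "A * E t + B * E u = 0\<^sub>m r r"
        using AE[OF cp(2)] BE[of k] A B k by (auto simp: u_def intro!: eq_matI)
      with D False show ?thesis by simp
    qed
    finally show ?thesis using zero_iff True by simp
  qed
qed

end

section \<open>Multiplying out the block circulant matrices\<close>

text \<open>The sum is formed in \<open>module_mat\<close>, while distributing a product over it
  needs a ring. For square matrices this record is \<open>ring_mat\<close> extended by scalar
  multiplication, which leaves the ring laws intact.\<close>

lemma ring_module_mat: "ring (module_mat TYPE('a :: comm_ring_1) k k)"
proof -
  have "module_mat TYPE('a) k k = ring_mat TYPE('a) k (ring.more (module_mat TYPE('a) k k))"
    by (simp add: module_mat_def ring_mat_def)
  then show ?thesis by (metis ring_mat)
qed

theorem theorem9p2:
  fixes n s1 s2 r :: nat and A B :: "complex mat"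
  assumes "s1 < s2" and "s2 \<le> n - 1"
    and "A \<in> carrier_mat r r" and "B \<in> carrier_mat r r"
    and "A * B = B * A"
    and "invertible_mat (perm_P n ^\<^sub>m s1 \<otimes>\<^sub>k A + perm_P n ^\<^sub>m s2 \<otimes>\<^sub>k B)"
    and "invertible_mat (A ^\<^sub>m quot_gcd n (s2 - s1) - (- B) ^\<^sub>m quot_gcd n (s2 - s1))"
  shows "mat_inverse (perm_P n ^\<^sub>m s1 \<otimes>\<^sub>k A + perm_P n ^\<^sub>m s2 \<otimes>\<^sub>k B) =
    Some (\<Oplus>\<^bsub>module_mat TYPE(complex) (n * r) (n * r)\<^esub> i \<in> {..<n}.
      perm_P n ^\<^sub>m i \<otimes>\<^sub>k Omega n (s2 - s1) A B (int i + int s1))"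
proof -
  note A = assms(3) and B = assms(4)
  define s where "s = s2 - s1"
  have s: "0 < s" "s < n" using assms(1,2) by (auto simp: s_def)
  have s2: "int s2 = int s1 + int s" using assms(1) by (simp add: s_def)
  let ?R = "module_mat TYPE(complex) (n * r) (n * r)"
  interpret R: ring ?R by (rule ring_module_mat)
  have car: "carrier ?R = carrier_mat (n * r) (n * r)" by (simp add: module_mat_simps)
  define W where "W = Omega n s A B"
  have W: "W i \<in> carrier_mat r r" for i
    unfolding W_def using Omega_carrier[OF s A B] assms(5,7) by (simp add: s_def)
  have W_cong: "W i = W j" if "[i = j] (mod int n)" for i j
    unfolding W_def by (rule Omega_cong[OF that])
  have K: "shift_mat n k \<otimes>\<^sub>k C \<in> carrier ?R" if "C \<in> carrier_mat r r" for k C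
    using that by (simp add: car)
  define X where "X = shift_mat n (int s1) \<otimes>\<^sub>k A + shift_mat n (int s2) \<otimes>\<^sub>k B"
  define f where "f i = shift_mat n (int i) \<otimes>\<^sub>k W (int i + int s1)" for i
  \<comment> \<open>\<open>F j\<close> and \<open>G j\<close> are the contributions with shift
    exponent \<open>j\<close> from the two summands of \<open>X\<close>. The first arises from
    \<open>j = i + s1\<close>; the second from \<open>j = i + s2\<close>, where the argument
    \<open>i + s1\<close> of \<open>W\<close> becomes \<open>j - s\<close>.\<close>
  define F where "F j = shift_mat n j \<otimes>\<^sub>k (A * W j)" for j
  define G where "G j = shift_mat n j \<otimes>\<^sub>k (B * W (j - int s))" for j
  have X: "X \<in> carrier ?R" using A B by (simp add: X_def car)
  have f: "f i \<in> carrier ?R" for i by (simp add: f_def K W)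
  have F: "F i \<in> carrier ?R" for i using A W by (simp add: F_def K)
  have G: "G i \<in> carrier ?R" for i using B W by (simp add: G_def K)
  have F_per: "F i = F j" if "[i = j] (mod int n)" for i j
    using W_cong[OF that] shift_mat_cong[OF that] by (simp add: F_def)
  have G_per: "G i = G j" if "[i = j] (mod int n)" for i j
    using W_cong[of "i - int s" "j - int s"] shift_mat_cong[OF that] cong_diff[OF that cong_refl]
    by (simp add: G_def)
  have Xf: "X * f i = F (int i + int s1) \<oplus>\<^bsub>?R\<^esub> G (int i + int s2)" for i
  proof -
    have "X * f i = (shift_mat n (int s1) \<otimes>\<^sub>k A) * f i + (shift_mat n (int s2) \<otimes>\<^sub>k B) * f i"
      unfolding X_def using f[of i] A B by (simp add: add_mult_distrib_mat[of _ "n * r" "n * r"] car)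
    also have "(shift_mat n (int s1) \<otimes>\<^sub>k A) * f i = F (int i + int s1)"
      unfolding f_def F_def using kronecker_mat_mult[OF shift_mat_carrier shift_mat_carrier A W]
      by (simp add: shift_mat_mult add.commute)
    also have "(shift_mat n (int s2) \<otimes>\<^sub>k B) * f i = G (int i + int s2)"
      unfolding f_def G_def using kronecker_mat_mult[OF shift_mat_carrier shift_mat_carrier B W]
      by (simp add: shift_mat_mult add.commute s2)
    finally show ?thesis by (simp add: module_mat_simps)
  qed
  have FG: "F (int i) \<oplus>\<^bsub>?R\<^esub> G (int i) = (if i = 0 then \<one>\<^bsub>?R\<^esub> else \<zero>\<^bsub>?R\<^esub>)" if "i < n" for i
  proof -
    have "F (int i) \<oplus>\<^bsub>?R\<^esub> G (int i)
        = shift_mat n (int i) \<otimes>\<^sub>k (A * W (int i) + B * W (int i - int s))"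
      unfolding F_def G_def
      using kronecker_mat_add_right[OF shift_mat_carrier, of "A * W (int i)" r r] A B W
      by (simp add: module_mat_simps)
    also have "A * W (int i) + B * W (int i - int s)
        = (if [int i = 0] (mod int n) then 1\<^sub>m r else 0\<^sub>m r r)"
      unfolding W_def using Omega_recurrence[OF s A B] assms(5,7) by (simp add: s_def)
    also have "[int i = 0] (mod int n) \<longleftrightarrow> i = 0"
      using that by (simp add: cong_def)
    finally show ?thesis
      by (simp add: module_mat_simps shift_mat_0 kronecker_mat_one
          kronecker_mat_zero_right[OF shift_mat_carrier])
  qed
  have "X * finsum ?R f {..<n} = (\<Oplus>\<^bsub>?R\<^esub>i\<in>{..<n}. X \<otimes>\<^bsub>?R\<^esub> f i)"
    using R.finsum_rdistr[of "{..<n}" X f] X f by (simp add: module_mat_simps)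
  also have "\<dots> = (\<Oplus>\<^bsub>?R\<^esub>i\<in>{..<n}. F (int i + int s1) \<oplus>\<^bsub>?R\<^esub> G (int i + int s2))"
    using Xf by (simp add: module_mat_simps)
  also have "\<dots> = (\<Oplus>\<^bsub>?R\<^esub>i\<in>{..<n}. F (int i + int s1)) \<oplus>\<^bsub>?R\<^esub> (\<Oplus>\<^bsub>?R\<^esub>i\<in>{..<n}. G (int i + int s2))"
    by (rule R.finsum_addf) (auto simp: F G)
  \<comment> \<open>The two sums run over differently shifted indices. Periodicity realigns both to
    \<open>i\<close>, after which they can be merged termwise and the coefficient identity
    applies.\<close>
  also have "(\<Oplus>\<^bsub>?R\<^esub>i\<in>{..<n}. F (int i + int s1)) = (\<Oplus>\<^bsub>?R\<^esub>i\<in>{..<n}. F (int i))"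
    by (rule R.finsum_periodic_shift) (auto simp: F F_per)
  also have "(\<Oplus>\<^bsub>?R\<^esub>i\<in>{..<n}. G (int i + int s2)) = (\<Oplus>\<^bsub>?R\<^esub>i\<in>{..<n}. G (int i))"
    by (rule R.finsum_periodic_shift) (auto simp: G G_per)
  also have "(\<Oplus>\<^bsub>?R\<^esub>i\<in>{..<n}. F (int i)) \<oplus>\<^bsub>?R\<^esub> (\<Oplus>\<^bsub>?R\<^esub>i\<in>{..<n}. G (int i))
      = (\<Oplus>\<^bsub>?R\<^esub>i\<in>{..<n}. F (int i) \<oplus>\<^bsub>?R\<^esub> G (int i))"
    by (rule R.finsum_addf[symmetric]) (auto simp: F G)
  also have "\<dots> = (\<Oplus>\<^bsub>?R\<^esub>i\<in>{..<n}. if 0 = i then \<one>\<^bsub>?R\<^esub> else \<zero>\<^bsub>?R\<^esub>)"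
    by (rule R.finsum_cong') (auto simp: FG)
  \<comment> \<open>Index 0 belongs to the range because \<open>s < n\<close> gives
    \<open>n > 0\<close>.\<close>
  also have "\<dots> = \<one>\<^bsub>?R\<^esub>"
    by (rule R.finsum_singleton) (use s in auto)
  finally have "X * finsum ?R f {..<n} = 1\<^sub>m (n * r)" by (simp add: module_mat_simps)
  moreover have "finsum ?R f {..<n} \<in> carrier_mat (n * r) (n * r)"
    using R.finsum_closed[of f "{..<n}"] f by (simp add: car)
  \<comment> \<open>The computation produced a right inverse; non-singularity of \<open>X\<close>
    identifies it with the inverse.\<close>
  moreover have "invertible_mat X" using assms(6) by (simp add: X_def perm_P_pow)
  ultimately have "mat_inverse X = Some (finsum ?R f {..<n})"
    using mat_inverse_eqI[of X "n * r"] X by (simp add: car)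
  then show ?thesis
    by (simp add: X_def f_def [abs_def] W_def s_def perm_P_pow)
qed

end
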